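(* Let $\{D_{n,i},\mathcal{F}_{n,i},\ 1\leq i\leq n\}$, $n\geq 1$, be a martingale-difference array and $\{c_n,\ n\geq 1\}$ a non-increasing sequence of positive numbers. Assume that $\mathcal{F}_{n,i}=\mathcal{F}_i$ for all $i,n$ (the sigma-algebras do not depend on $n$). Then for all integers $1\le n\leq m\leq N$ (with $m$ the running index of the maximum below), all real $p\geq 1$ and all $\lambda>0$, $$2^{-p}\lambda^p\,\mathbb{P}\left(\max_{n\leq m\leq N}c_m|M_{m,m}|>\lambda\right)\leq c_N^p\,\mathbb{E}\left(|S_{n,N}|^p\right)+\sum_{j=n}^{N-1}\left(c_j^p-c_{j+1}^p\right)\mathbb{E}\left(|S_{n,j}|^p\right)+\mathbb{E}\left[\left(\sum_{j=n+1}^N c_j|R_j|\right)^p\right].$$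
   Context: $(\Omega,\mathcal{F},\mathbb{P})$ is a probability space with expectation $\mathbb{E}$. A martingale-difference array $\{D_{n,i},\mathcal{F}_{n,i},\ 1\leq i\leq n\}$, $n\geq 1$, consists, for each $n\ge 1$, of a non-decreasing sequence $\{\mathcal{F}_{n,i},\ 1\le i\le n\}$ of sub-sigma-algebras of $\mathcal{F}$ and real random variables $D_{n,i}$, $1\le i\le n$, with $D_{n,i}$ being $\mathcal{F}_{n,i}$-measurable, $\mathbb{E}(|D_{n,i}|)<\infty$ and $\mathbb{E}(D_{n,i}\mid\mathcal{F}_{n,i-1})=0$ for all $1\le i\le n$, where $\mathcal{F}_{n,0}=\{\emptyset,\Omega\}$. Notation: $M_{n,k}:=\sum_{i=1}^k D_{n,i}$ for $1\le k\le n$, $n\ge 1$. For $n\ge1$, $$S_{n,k}:=M_{n,k}=\sum_{i=1}^k D_{n,i}\ \text{ if } 1\le k\le n,\qquad S_{n,k}:=\sum_{i=1}^n D_{n,i}+\sum_{j=n+1}^k D_{j,j}\ \text{ if } k>n.$$ Finally $R_n:=\sum_{j=1}^{n-1}\left(D_{n,j}-D_{n-1,j}\right)$ (an empty sum is $0$). *)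

theory Defs
  imports "HOL-Probability.Probability"
begin

(* A sigma-algebra on the sample space is encoded as a measure F of which only
   space F and sets F matter.  Row n of an array is indexed by 1 <= i <= n (n >= 1);
   F n 0 is by convention the trivial sigma-algebra, and all other index values of
   F and D are unconstrained. *)

definition martingale_difference_array ::
  "'a measure \<Rightarrow> (nat \<Rightarrow> nat \<Rightarrow> 'a measure) \<Rightarrow> (nat \<Rightarrow> nat \<Rightarrow> 'a \<Rightarrow> real) \<Rightarrow> bool" where
  "martingale_difference_array M F D \<longleftrightarrow>
    (\<forall>n\<ge>1.
      sets (F n 0) = {{}, space M} \<and>
      (\<forall>i\<in>{1..n}. subalgebra M (F n i)) \<and>
      (\<forall>i\<in>{1..n}. \<forall>j\<in>{i..n}. sets (F n i) \<subseteq> sets (F n j)) \<and>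
      (\<forall>i\<in>{1..n}.
        D n i \<in> borel_measurable (F n i) \<and>
        integrable M (D n i) \<and>
        (AE \<omega> in M. real_cond_exp M (F n (i - 1)) (D n i) \<omega> = 0)))"

definition row_sum :: "(nat \<Rightarrow> nat \<Rightarrow> 'a \<Rightarrow> real) \<Rightarrow> nat \<Rightarrow> nat \<Rightarrow> 'a \<Rightarrow> real" where
  "row_sum D n k \<omega> = (\<Sum>i=1..k. D n i \<omega>)"

definition extended_sum :: "(nat \<Rightarrow> nat \<Rightarrow> 'a \<Rightarrow> real) \<Rightarrow> nat \<Rightarrow> nat \<Rightarrow> 'a \<Rightarrow> real" where
  "extended_sum D n k \<omega> =
    (if k \<le> n then row_sum D n k \<omega>
     else (\<Sum>i=1..n. D n i \<omega>) + (\<Sum>j=n+1..k. D j j \<omega>))"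

definition row_change :: "(nat \<Rightarrow> nat \<Rightarrow> 'a \<Rightarrow> real) \<Rightarrow> nat \<Rightarrow> 'a \<Rightarrow> real" where
  "row_change D n \<omega> = (\<Sum>j=1..n-1. D n j \<omega> - D (n-1) j \<omega>)"

end

theory Submission
  imports Defs
begin

text \<open>
  Passing from row \<open>j - 1\<close> to row \<open>j\<close> changes the diagonal sum by \<open>D\<^sub>j\<^sub>,\<^sub>j + R\<^sub>j\<close>, so
  \<open>M\<^sub>m\<^sub>,\<^sub>m = S\<^sub>n\<^sub>,\<^sub>m + \<Sum>\<^sub>n\<^sub><\<^sub>j\<^sub>\<le>\<^sub>m R\<^sub>j\<close>, and as \<open>c\<close> is non-increasing the event lies in the union of
  \<open>{\<exists>m. c\<^sub>m |S\<^sub>n\<^sub>,\<^sub>m| > \<lambda>/2}\<close> and \<open>{\<Sum>\<^sub>j c\<^sub>j |R\<^sub>j| > \<lambda>/2}\<close>. Markov's inequality bounds the second.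
  Since the sigma-algebras do not depend on the row, \<open>(S\<^sub>n\<^sub>,\<^sub>m)\<^sub>m\<^sub>\<ge>\<^sub>n\<close> is a martingale, so
  \<open>|S\<^sub>n\<^sub>,\<^sub>m|\<^sup>p\<close> is a (possibly non-integrable) submartingale, and the Hajek--Renyi--Chow maximal
  inequality bounds the first.
\<close>

section \<open>Tangent inequalities for powers\<close>

text \<open>This is the tangent line at 1 of the convex map \<open>t powr p\<close>. The tangent
  rule is applied on the open half-line, so \<open>t = 0\<close> is separate; there the claim is
  \<open>1 - p \<le> 0\<close>.\<close>

lemma bernoulli_powr:
  fixes t p :: real
  assumes "0 \<le> t" "1 \<le> p"
  shows "1 + p * (t - 1) \<le> t powr p"
proof (cases "t = 0")
  case False
  have "p * (t - 1) \<le> t powr p - 1 powr p"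
  proof (rule convex_on_imp_above_tangent[OF powr_convex[OF assms(2)]])
    show "((\<lambda>x. x powr p) has_field_derivative p) (at 1 within {0<..})"
      by (auto intro!: derivative_eq_intros)
  qed (use False assms in \<open>auto simp: interior_open\<close>)
  then show ?thesis by simp
qed (use assms in auto)

text \<open>Dividing by \<open>\<bar>x\<bar> powr p\<close> reduces this subgradient inequality to
  \<open>bernoulli_powr\<close> with \<open>t = \<bar>x + y\<bar> / \<bar>x\<bar>\<close>, because
  \<open>sgn x * y \<le> \<bar>x + y\<bar> - \<bar>x\<bar>\<close>.\<close>

lemma abs_powr_above_tangent:
  fixes x y p :: real
  assumes "1 \<le> p"
  shows "\<bar>x\<bar> powr p + p * \<bar>x\<bar> powr (p - 1) * sgn x * y \<le> \<bar>x + y\<bar> powr p"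
proof (cases "x = 0")
  case False
  have "\<bar>x\<bar> powr p + p * \<bar>x\<bar> powr (p - 1) * (sgn x * y)
      \<le> \<bar>x\<bar> powr p + p * \<bar>x\<bar> powr (p - 1) * (\<bar>x + y\<bar> - \<bar>x\<bar>)"
    using assms by (intro add_left_mono mult_left_mono) (auto simp: sgn_real_def)
  also have "\<dots> = \<bar>x\<bar> powr p * (1 + p * (\<bar>x + y\<bar> / \<bar>x\<bar> - 1))"
    using False by (simp add: powr_diff field_simps)
  also have "\<dots> \<le> \<bar>x\<bar> powr p * (\<bar>x + y\<bar> / \<bar>x\<bar>) powr p"
    using assms by (intro mult_left_mono bernoulli_powr) auto
  also have "\<dots> = \<bar>x + y\<bar> powr p"
    using False by (simp add: powr_divide)
  finally show ?thesis by (simp add: mult.assoc)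
qed simp

section \<open>One submartingale step for powers\<close>

text \<open>A localised conditional Jensen inequality in which both sides may be infinite. The slope
  of the tangent at \<open>S\<close> is \<open>F\<close>-measurable, so the linear term in
  \<open>X\<close> integrates to 0 over events of \<open>F\<close>, once it is made
  integrable.\<close>

lemma (in prob_space) powr_martingale_step:
  fixes S X :: "'a \<Rightarrow> real"
  assumes F: "subalgebra M F"
    and S[measurable]: "S \<in> borel_measurable F"
    and X: "integrable M X" "AE \<omega> in M. real_cond_exp M F X \<omega> = 0"
    and B[measurable]: "B \<in> sets F" and p: "1 \<le> p"
  shows "(\<integral>\<^sup>+\<omega>\<in>B. ennreal (\<bar>S \<omega>\<bar> powr p) \<partial>M) \<le> (\<integral>\<^sup>+\<omega>\<in>B. ennreal (\<bar>S \<omega> + X \<omega>\<bar> powr p) \<partial>M)"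
proof -
  interpret finite_measure_subalgebra M F
    by unfold_locales (rule F)
  have XM[measurable]: "X \<in> borel_measurable M"
    using X by auto
  have SM[measurable]: "S \<in> borel_measurable M"
    using measurable_from_subalg[OF F S] .
  have BM[measurable]: "B \<in> sets M"
    using B F by (auto simp: subalgebra_def)
  define C where "C k = {\<omega>\<in>space F. \<bar>S \<omega>\<bar> \<le> real k} \<inter> B" for k
  have CF[measurable]: "C k \<in> sets F" for k
    unfolding C_def by measurable
  then have CM[measurable]: "C k \<in> sets M" for k
    using F by (auto simp: subalgebra_def)
  \<comment> \<open>Truncating \<open>S\<close> makes the tangent term integrable without assuming \<open>S\<close> in \<open>L\<^sup>p\<close>.\<close>
  have step: "(\<integral>\<^sup>+\<omega>\<in>C k. ennreal (\<bar>S \<omega>\<bar> powr p) \<partial>M)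
      \<le> (\<integral>\<^sup>+\<omega>\<in>B. ennreal (\<bar>S \<omega> + X \<omega>\<bar> powr p) \<partial>M)" for k
  proof -
    \<comment> \<open>\<open>f\<close> and \<open>h\<close> are the value and the slope of the
      tangent at \<open>S\<close>, cut off outside \<open>C k\<close>; both are bounded because
      \<open>\<bar>S\<bar> \<le> k\<close> there.\<close>
    define f where "f \<omega> = indicator (C k) \<omega> * \<bar>S \<omega>\<bar> powr p" for \<omega>
    define h where "h \<omega> = indicator (C k) \<omega> * (p * \<bar>S \<omega>\<bar> powr (p - 1) * sgn (S \<omega>))" for \<omega>
    have f_int: "integrable M f"
    proof (rule integrable_const_bound)
      show "AE \<omega> in M. norm (f \<omega>) \<le> real k powr p"
        using p by (auto simp: f_def C_def indicator_def intro!: powr_mono2)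
      show "f \<in> borel_measurable M"
        unfolding f_def by measurable
    qed
    have h_meas[measurable]: "h \<in> borel_measurable F"
      unfolding h_def sgn_real_def by measurable
    have h_bound: "\<bar>h \<omega>\<bar> \<le> p * real k powr (p - 1)" for \<omega>
      using p by (auto simp: h_def C_def indicator_def abs_mult sgn_real_def intro!: powr_mono2)
    have hX_int: "integrable M (\<lambda>\<omega>. h \<omega> * X \<omega>)"
    proof (rule Bochner_Integration.integrable_bound)
      show "integrable M (\<lambda>\<omega>. p * real k powr (p - 1) * X \<omega>)"
        using X by simp
      show "(\<lambda>\<omega>. h \<omega> * X \<omega>) \<in> borel_measurable M"
        using measurable_from_subalg[OF F h_meas] by measurable
      show "AE \<omega> in M. norm (h \<omega> * X \<omega>) \<le> norm (p * real k powr (p - 1) * X \<omega>)"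
        using h_bound p by (auto simp: abs_mult intro!: mult_right_mono)
    qed
    have "(\<integral>\<omega>. h \<omega> * X \<omega> \<partial>M) = (\<integral>\<omega>. h \<omega> * real_cond_exp M F X \<omega> \<partial>M)"
      using real_cond_exp_intg(2)[OF hX_int] by simp
    also have "\<dots> = 0"
      using X(2) by (intro integral_eq_zero_AE) auto
    finally have hX_zero: "(\<integral>\<omega>. h \<omega> * X \<omega> \<partial>M) = 0" .
    have "(\<integral>\<^sup>+\<omega>\<in>C k. ennreal (\<bar>S \<omega>\<bar> powr p) \<partial>M) = (\<integral>\<^sup>+\<omega>. ennreal (f \<omega>) \<partial>M)"
      by (intro nn_integral_cong) (auto simp: f_def indicator_def)
    also have "\<dots> = ennreal (\<integral>\<omega>. f \<omega> \<partial>M)"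
      by (intro nn_integral_eq_integral f_int) (simp add: f_def)
    also have "(\<integral>\<omega>. f \<omega> \<partial>M) = (\<integral>\<omega>. f \<omega> + h \<omega> * X \<omega> \<partial>M)"
      using f_int hX_int hX_zero by simp
    \<comment> \<open>The positive part permits the return to a nonnegative integral. It costs
      nothing, since the upper bound \<open>\<bar>S + X\<bar> powr p\<close> is itself
      nonnegative.\<close>
    also have "\<dots> \<le> ennreal (\<integral>\<omega>. max 0 (f \<omega> + h \<omega> * X \<omega>) \<partial>M)"
      using f_int hX_int by (intro ennreal_leI integral_mono) auto
    also have "\<dots> = (\<integral>\<^sup>+\<omega>. ennreal (max 0 (f \<omega> + h \<omega> * X \<omega>)) \<partial>M)"
      using f_int hX_int by (subst nn_integral_eq_integral) auto
    also have "\<dots> \<le> (\<integral>\<^sup>+\<omega>\<in>B. ennreal (\<bar>S \<omega> + X \<omega>\<bar> powr p) \<partial>M)"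
      using abs_powr_above_tangent[OF p]
      by (intro nn_integral_mono) (auto simp: f_def h_def C_def indicator_def intro!: ennreal_leI)
    finally show ?thesis .
  qed
  \<comment> \<open>The truncation is removed by continuity from below of the measure with density
    \<open>\<bar>S\<bar> powr p\<close>, as the sets \<open>C k\<close> increase to
    \<open>B\<close>.\<close>
  have "(\<integral>\<^sup>+\<omega>\<in>B. ennreal (\<bar>S \<omega>\<bar> powr p) \<partial>M) = emeasure (density M (\<lambda>\<omega>. ennreal (\<bar>S \<omega>\<bar> powr p))) B"
    by (simp add: emeasure_density)
  also have "\<dots> = emeasure (density M (\<lambda>\<omega>. ennreal (\<bar>S \<omega>\<bar> powr p))) (\<Union>k. C k)"
    using subsetD[OF sets.sets_into_space[OF B]] real_arch_simple by (intro arg_cong[where f="emeasure _"]) (auto simp: C_def)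
  also have "\<dots> = (SUP k. emeasure (density M (\<lambda>\<omega>. ennreal (\<bar>S \<omega>\<bar> powr p))) (C k))"
    using CM by (intro SUP_emeasure_incseq[symmetric]) (auto simp: incseq_def C_def)
  also have "\<dots> \<le> (\<integral>\<^sup>+\<omega>\<in>B. ennreal (\<bar>S \<omega> + X \<omega>\<bar> powr p) \<partial>M)"
    using step by (intro SUP_least) (simp add: emeasure_density)
  finally show ?thesis .
qed

section \<open>The maximal inequality for weighted submartingales\<close>

text \<open>Abel summation without subtracting integrals: split \<open>b n\<close> into
  \<open>b (Suc n)\<close> and \<open>b n - b (Suc n)\<close>, leave the second share at time
  \<open>n\<close>, and carry the first to time \<open>Suc n\<close> by the submartingale property.
  It serves for the event on which the level is already exceeded at the initial time.\<close>

lemma submartingale_telescope_le: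
  fixes X :: "nat \<Rightarrow> 'a \<Rightarrow> ennreal" and b :: "nat \<Rightarrow> real"
  assumes "n \<le> N"
    and mono: "\<And>k. n \<le> k \<Longrightarrow> k < N \<Longrightarrow> sets (G k) \<subseteq> sets (G (Suc k))"
    and sub: "\<And>k B. n \<le> k \<Longrightarrow> k < N \<Longrightarrow> B \<in> sets (G k) \<Longrightarrow>
      (\<integral>\<^sup>+\<omega>\<in>B. X k \<omega> \<partial>M) \<le> (\<integral>\<^sup>+\<omega>\<in>B. X (Suc k) \<omega> \<partial>M)"
    and b: "\<And>k. n \<le> k \<Longrightarrow> k \<le> N \<Longrightarrow> 0 \<le> b k" "\<And>k. n \<le> k \<Longrightarrow> k < N \<Longrightarrow> b (Suc k) \<le> b k"
    and B: "B \<in> sets (G n)"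
  shows "ennreal (b n) * (\<integral>\<^sup>+\<omega>\<in>B. X n \<omega> \<partial>M)
    \<le> ennreal (b N) * (\<integral>\<^sup>+\<omega>\<in>B. X N \<omega> \<partial>M)
      + (\<Sum>j=n..<N. ennreal (b j - b (Suc j)) * (\<integral>\<^sup>+\<omega>\<in>B. X j \<omega> \<partial>M))"
  using assms
proof (induction rule: inc_induct)
  case (step n)
  let ?I = "\<lambda>j. \<integral>\<^sup>+\<omega>\<in>B. X j \<omega> \<partial>M"
  have "ennreal (b n) * ?I n = ennreal (b (Suc n)) * ?I n + ennreal (b n - b (Suc n)) * ?I n"
    using step by (simp flip: distrib_right ennreal_plus)
  also have "\<dots> \<le> ennreal (b (Suc n)) * ?I (Suc n) + ennreal (b n - b (Suc n)) * ?I n"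
    using step by (intro add_mono mult_left_mono) auto
  also have "ennreal (b (Suc n)) * ?I (Suc n)
      \<le> ennreal (b N) * ?I N + (\<Sum>j=Suc n..<N. ennreal (b j - b (Suc j)) * ?I j)"
    using step.prems step.hyps(2) by (intro step.IH) (auto dest: step.prems(1)[THEN subsetD, rotated 2])
  finally show ?case
    using step.hyps by (simp add: sum.atLeast_Suc_lessThan add_ac)
qed simp

text \<open>
  The bound is localised to events \<open>B\<close> of the initial sigma-algebra: splitting \<open>B\<close> according to
  whether \<open>b\<^sub>n X\<^sub>n > a\<close> allows induction on \<open>n\<close> downwards from \<open>N\<close>, a direction that avoids
  subtracting expectations, which may be infinite.
\<close>

lemma hajek_renyi_chow:
  fixes X :: "nat \<Rightarrow> 'a \<Rightarrow> ennreal" and b :: "nat \<Rightarrow> real"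
  assumes "n \<le> N"
    and G: "\<And>k. n \<le> k \<Longrightarrow> k \<le> N \<Longrightarrow> subalgebra M (G k)"
    and mono: "\<And>k. n \<le> k \<Longrightarrow> k < N \<Longrightarrow> sets (G k) \<subseteq> sets (G (Suc k))"
    and X: "\<And>k. n \<le> k \<Longrightarrow> k \<le> N \<Longrightarrow> X k \<in> borel_measurable (G k)"
    and sub: "\<And>k B. n \<le> k \<Longrightarrow> k < N \<Longrightarrow> B \<in> sets (G k) \<Longrightarrow>
      (\<integral>\<^sup>+\<omega>\<in>B. X k \<omega> \<partial>M) \<le> (\<integral>\<^sup>+\<omega>\<in>B. X (Suc k) \<omega> \<partial>M)"
    and b: "\<And>k. n \<le> k \<Longrightarrow> k \<le> N \<Longrightarrow> 0 \<le> b k" "\<And>k. n \<le> k \<Longrightarrow> k < N \<Longrightarrow> b (Suc k) \<le> b k"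
    and B: "B \<in> sets (G n)"
  shows "a * emeasure M {\<omega>\<in>B. \<exists>k\<in>{n..N}. a < ennreal (b k) * X k \<omega>}
    \<le> ennreal (b N) * (\<integral>\<^sup>+\<omega>\<in>B. X N \<omega> \<partial>M)
      + (\<Sum>j=n..<N. ennreal (b j - b (Suc j)) * (\<integral>\<^sup>+\<omega>\<in>B. X j \<omega> \<partial>M))"
proof -
  \<comment> \<open>The right-hand side with starting index and event left free, since the induction
    changes both.\<close>
  define W where "W n B = ennreal (b N) * (\<integral>\<^sup>+\<omega>\<in>B. X N \<omega> \<partial>M)
      + (\<Sum>j=n..<N. ennreal (b j - b (Suc j)) * (\<integral>\<^sup>+\<omega>\<in>B. X j \<omega> \<partial>M))" for n B
  have XM: "X k \<in> borel_measurable M" if "n \<le> k" "k \<le> N" for k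
    using measurable_from_subalg[OF G X] that by blast
  have GM: "A \<in> sets M" if "A \<in> sets (G k)" "n \<le> k" "k \<le> N" for A k
    using G[of k] that by (auto simp: subalgebra_def)
  \<comment> \<open>Markov's inequality at a single time, keeping the integral on the exceedance
    event only.\<close>
  have exceed: "a * emeasure M {\<omega>\<in>A. a < ennreal (b k) * X k \<omega>}
      \<le> ennreal (b k) * (\<integral>\<^sup>+\<omega>\<in>{\<omega>\<in>A. a < ennreal (b k) * X k \<omega>}. X k \<omega> \<partial>M)"
    if A: "A \<in> sets M" and k: "n \<le> k" "k \<le> N" for A k
  proof -
    note XM[OF k, measurable]
    have A': "{\<omega>\<in>A. a < ennreal (b k) * X k \<omega>} \<in> sets M" (is "?A \<in> _")
    proof -
      have "?A = A \<inter> {\<omega>\<in>space M. a < ennreal (b k) * X k \<omega>}"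
        using sets.sets_into_space[OF A] by auto
      also have "\<dots> \<in> sets M" using A by measurable
      finally show ?thesis .
    qed
    note A'[measurable]
    have "a * emeasure M ?A = (\<integral>\<^sup>+\<omega>. a * indicator ?A \<omega> \<partial>M)"
      by (simp add: nn_integral_cmult_indicator)
    also have "\<dots> \<le> (\<integral>\<^sup>+\<omega>. ennreal (b k) * (X k \<omega> * indicator ?A \<omega>) \<partial>M)"
      by (intro nn_integral_mono) (auto simp: indicator_def)
    also have "\<dots> = ennreal (b k) * (\<integral>\<^sup>+\<omega>\<in>?A. X k \<omega> \<partial>M)"
      by (intro nn_integral_cmult) measurable
    finally show ?thesis .
  qed
  have W_add: "W k A + W k A' = W k (A \<union> A')"
    if "n \<le> k" "k \<le> N" "A \<in> sets M" "A' \<in> sets M" "A \<inter> A' = {}" for k A A'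
  proof -
    have "(\<integral>\<^sup>+\<omega>\<in>A \<union> A'. X j \<omega> \<partial>M) = (\<integral>\<^sup>+\<omega>\<in>A. X j \<omega> \<partial>M) + (\<integral>\<^sup>+\<omega>\<in>A'. X j \<omega> \<partial>M)"
      if "k \<le> j" "j \<le> N" for j
      using plus_emeasure[of A "density M (X j)" A'] XM[of j] that \<open>n \<le> k\<close> \<open>A \<in> sets M\<close>
        \<open>A' \<in> sets M\<close> \<open>A \<inter> A' = {}\<close>
      by (simp add: emeasure_density)
    then show ?thesis
      using \<open>k \<le> N\<close> by (simp add: W_def distrib_left sum.distrib add_ac)
  qed
  have "\<forall>B\<in>sets (G m). a * emeasure M {\<omega>\<in>B. \<exists>k\<in>{m..N}. a < ennreal (b k) * X k \<omega>} \<le> W m B"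
    if "m \<le> N" "n \<le> m" for m
    using that
  proof (induction rule: inc_induct)
    case base
    show ?case
    proof
      fix B assume B: "B \<in> sets (G N)"
      have "a * emeasure M {\<omega>\<in>B. a < ennreal (b N) * X N \<omega>}
          \<le> ennreal (b N) * (\<integral>\<^sup>+\<omega>\<in>{\<omega>\<in>B. a < ennreal (b N) * X N \<omega>}. X N \<omega> \<partial>M)"
        using GM[OF B] assms(1) by (intro exceed) auto
      also have "\<dots> \<le> W N B"
        by (auto simp: W_def intro!: mult_left_mono nn_integral_mono split: split_indicator)
      finally show "a * emeasure M {\<omega>\<in>B. \<exists>k\<in>{N..N}. a < ennreal (b k) * X k \<omega>} \<le> W N B"
        by simp
    qed
  next
    case (step m)
    show ?case
    proof
      fix B assume B: "B \<in> sets (G m)"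
      define B1 B2 where "B1 = {\<omega>\<in>B. a < ennreal (b m) * X m \<omega>}" and "B2 = B - B1"
      have Xm[measurable]: "X m \<in> borel_measurable (G m)"
        using step by (intro X) auto
      have "B1 = B \<inter> {\<omega>\<in>space (G m). a < ennreal (b m) * X m \<omega>}"
        using sets.sets_into_space[OF B] by (auto simp: B1_def)
      also have "\<dots> \<in> sets (G m)" using B by measurable
      finally have B1: "B1 \<in> sets (G m)" .
      have B2: "B2 \<in> sets (G m)" "B2 \<in> sets (G (Suc m))"
        using B B1 mono[of m] step by (auto simp: B2_def)
      let ?E = "{\<omega>\<in>B2. \<exists>k\<in>{Suc m..N}. a < ennreal (b k) * X k \<omega>}"
      have "?E = B2 \<inter> (\<Union>k\<in>{Suc m..N}. {\<omega>\<in>space M. a < ennreal (b k) * X k \<omega>})"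
        using sets.sets_into_space[OF GM[OF B2(1)]] step by auto
      also have "\<dots> \<in> sets M"
      proof (intro sets.Int sets.finite_UN)
        show "{\<omega>\<in>space M. a < ennreal (b k) * X k \<omega>} \<in> sets M" if "k \<in> {Suc m..N}" for k
        proof -
          have [measurable]: "X k \<in> borel_measurable M" using XM that step by auto
          show ?thesis by measurable
        qed
        show "B2 \<in> sets M" using GM[OF B2(1)] step by auto
      qed simp
      finally have E: "?E \<in> sets M" .
      have split: "{\<omega>\<in>B. \<exists>k\<in>{m..N}. a < ennreal (b k) * X k \<omega>} = B1 \<union> ?E"
        using step.hyps atLeastAtMost_insertL[of m N] by (auto simp: B1_def B2_def)
      have "a * emeasure M (B1 \<union> ?E) = a * emeasure M B1 + a * emeasure M ?E"
        using GM[OF B1] E step by (subst plus_emeasure[symmetric]) (auto simp: B2_def distrib_left)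
      also have "\<dots> \<le> W m B1 + W m B2"
      proof (rule add_mono)
        have "a * emeasure M B1 \<le> ennreal (b m) * (\<integral>\<^sup>+\<omega>\<in>B1. X m \<omega> \<partial>M)"
          unfolding B1_def using GM[OF B] step by (intro exceed) auto
        also have "\<dots> \<le> W m B1"
          unfolding W_def using step B1
          by (intro submartingale_telescope_le[where G=G] mono sub b) auto
        finally show "a * emeasure M B1 \<le> W m B1" .
        \<comment> \<open>The induction hypothesis applies because \<open>B2\<close> also belongs to
          \<open>G (Suc m)\<close>. Passing on to \<open>W m\<close> only adds the nonnegative
          summand with \<open>j = m\<close>.\<close>
        have "a * emeasure M ?E \<le> W (Suc m) B2"
          using step B2(2) by auto
        also have "\<dots> \<le> W m B2"
          unfolding W_def by (intro add_mono sum_mono2) auto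
        finally show "a * emeasure M ?E \<le> W m B2" .
      qed
      also have "\<dots> = W m B"
        using W_add[of m B1 B2] GM[OF B1] GM[OF B2(1)] step
        by (auto simp: B2_def B1_def Un_absorb1)
      finally show "a * emeasure M {\<omega>\<in>B. \<exists>k\<in>{m..N}. a < ennreal (b k) * X k \<omega>} \<le> W m B"
        unfolding split .
    qed
  qed
  then show ?thesis
    using B assms(1) by (simp add: W_def)
qed

section \<open>Diagonal sums of the array\<close>

lemma extended_sum_Suc:
  "n \<le> m \<Longrightarrow> extended_sum D n (Suc m) \<omega> = extended_sum D n m \<omega> + D (Suc m) (Suc m) \<omega>"
  by (cases "n = m") (auto simp: extended_sum_def row_sum_def)

text \<open>Replacing row \<open>m\<close> by row \<open>Suc m\<close> alters the first
  \<open>m\<close> entries by a total of \<open>row_change D (Suc m)\<close>; the one new entry is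
  the diagonal term that \<open>extended_sum\<close> appends as well.\<close>

lemma row_sum_diagonal_eq:
  assumes "n \<le> m"
  shows "row_sum D m m \<omega> = extended_sum D n m \<omega> + (\<Sum>j=n+1..m. row_change D j \<omega>)"
  using assms
proof (induction rule: dec_induct)
  case base
  then show ?case by (simp add: extended_sum_def)
next
  case (step m)
  have "row_sum D (Suc m) (Suc m) \<omega> = row_sum D m m \<omega> + D (Suc m) (Suc m) \<omega> + row_change D (Suc m) \<omega>"
    by (simp add: row_sum_def row_change_def sum_subtractf)
  with step show ?case by (simp add: extended_sum_Suc)
qed

theorem theorem1p2:
  fixes M :: "'a measure"
    and F :: "nat \<Rightarrow> nat \<Rightarrow> 'a measure"
    and G :: "nat \<Rightarrow> 'a measure"
    and D :: "nat \<Rightarrow> nat \<Rightarrow> 'a \<Rightarrow> real"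
    and c :: "nat \<Rightarrow> real"
    and n N :: nat
    and p lam :: real
  assumes "prob_space M"
    and "martingale_difference_array M F D"
    and "\<And>k i. 1 \<le> i \<Longrightarrow> i \<le> k \<Longrightarrow> sets (F k i) = sets (G i)"
    and "\<And>k. 1 \<le> k \<Longrightarrow> c k > 0"
    and "antimono_on {1..} c"
    and "1 \<le> n" and "n \<le> N"
    and "p \<ge> 1" and "lam > 0"
  shows "ennreal (2 powr (- p) * lam powr p) *
        emeasure M {\<omega> \<in> space M. Max ((\<lambda>m. c m * \<bar>row_sum D m m \<omega>\<bar>) ` {n..N}) > lam}
    \<le> ennreal (c N powr p) * (\<integral>\<^sup>+ \<omega>. ennreal (\<bar>extended_sum D n N \<omega>\<bar> powr p) \<partial>M)
      + (\<Sum>j=n..<N. ennreal (c j powr p - c (j + 1) powr p) *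
            (\<integral>\<^sup>+ \<omega>. ennreal (\<bar>extended_sum D n j \<omega>\<bar> powr p) \<partial>M))
      + (\<integral>\<^sup>+ \<omega>. ennreal ((\<Sum>j=n+1..N. c j * \<bar>row_change D j \<omega>\<bar>) powr p) \<partial>M)"
proof -
  interpret prob_space M by fact
  note D = assms(2)[unfolded martingale_difference_array_def, rule_format]
  define S where "S = extended_sum D n"
  define T where "T \<omega> = (\<Sum>j=n+1..N. c j * \<bar>row_change D j \<omega>\<bar>)" for \<omega>
  \<comment> \<open>Half of \<open>lam\<close> goes to each of the two events, which produces the
    factor \<open>2 powr (- p)\<close>.\<close>
  define a where "a = (lam / 2) powr p"
  define E1 where "E1 = {\<omega>\<in>space M. \<exists>k\<in>{n..N}. ennreal a < ennreal (c k powr p) * ennreal (\<bar>S k \<omega>\<bar> powr p)}"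
  define E2 where "E2 = {\<omega>\<in>space M. ennreal a \<le> ennreal (T \<omega> powr p)}"
  have sub: "subalgebra M (F k i)" if "1 \<le> i" "i \<le> k" for k i
    using D[of k] that by auto
  have D_diag: "integrable M (D k k)" "AE \<omega> in M. real_cond_exp M (F k (k - 1)) (D k k) \<omega> = 0"
    if "1 \<le> k" for k
    using D[of k] that by auto
  \<comment> \<open>Here the independence of the row enters: sigma-algebras of different rows become
    comparable. Hence \<open>S k\<close>, which mixes entries of row \<open>n\<close> with diagonal
    ones, is measurable for \<open>F k k\<close>.\<close>
  have mono: "sets (F k i) \<subseteq> sets (F m j)" if "1 \<le> i" "i \<le> j" "i \<le> k" "j \<le> m" for k i m j
  proof -
    have "sets (F k i) = sets (F m i)"
      using that assms(3)[of i k] assms(3)[of i m] by simp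
    also have "\<dots> \<subseteq> sets (F m j)"
      using D[of m] that by auto
    finally show ?thesis .
  qed
  have meas: "D k i \<in> borel_measurable (F m j)" if "1 \<le> i" "i \<le> j" "i \<le> k" "j \<le> m" for k i m j
    using D[of k] mono[OF that] sub[of i k] sub[of j m] that
    by (intro measurable_from_subalg[of "F m j" "F k i"]) (auto simp: subalgebra_def)
  have D_meas[measurable]: "D k i \<in> borel_measurable M" if "1 \<le> i" "i \<le> k" for k i
    using measurable_from_subalg[OF sub meas] that by blast
  have S_meas: "S k \<in> borel_measurable (F k k)" if "n \<le> k" for k
    unfolding S_def extended_sum_def row_sum_def using that assms(6)
    by (cases "k = n") (auto intro!: borel_measurable_sum borel_measurable_add meas)
  have c_mono: "c j \<le> c i" if "1 \<le> i" "i \<le> j" for i j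
    using assms(5) that by (auto simp: monotone_on_def)
  have c_pos: "0 < c k" if "n \<le> k" for k
    using assms(4,6) that by auto
  have T_meas[measurable]: "T \<in> borel_measurable M"
    unfolding T_def row_change_def using assms(6)
    by (intro borel_measurable_sum borel_measurable_times borel_measurable_abs borel_measurable_diff)
       (auto intro!: D_meas)
  have E1: "E1 \<in> sets M"
  proof -
    have "E1 = (\<Union>k\<in>{n..N}. {\<omega>\<in>space M. ennreal a < ennreal (c k powr p) * ennreal (\<bar>S k \<omega>\<bar> powr p)})"
      by (auto simp: E1_def)
    also have "\<dots> \<in> sets M"
    proof (intro sets.finite_UN)
      fix k assume k: "k \<in> {n..N}"
      have [measurable]: "S k \<in> borel_measurable M"
        using k assms(6) measurable_from_subalg[OF sub[of k k] S_meas[of k]] by auto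
      show "{\<omega>\<in>space M. ennreal a < ennreal (c k powr p) * ennreal (\<bar>S k \<omega>\<bar> powr p)} \<in> sets M"
        by measurable
    qed simp
    finally show ?thesis .
  qed
  have E2: "E2 \<in> sets M"
    unfolding E2_def by measurable
  have cover: "\<omega> \<in> E1 \<union> E2"
    if \<omega>: "\<omega> \<in> space M" "lam < Max ((\<lambda>m. c m * \<bar>row_sum D m m \<omega>\<bar>) ` {n..N})" for \<omega>
  proof -
    obtain m where m: "n \<le> m" "m \<le> N" "lam < c m * \<bar>row_sum D m m \<omega>\<bar>"
      using \<omega>(2) assms(7) by (subst (asm) Max_gr_iff) auto
    have "c m * \<bar>row_sum D m m \<omega>\<bar>
        \<le> c m * (\<bar>S m \<omega>\<bar> + (\<Sum>j=n+1..m. \<bar>row_change D j \<omega>\<bar>))"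
      unfolding row_sum_diagonal_eq[OF m(1), of D] S_def using c_pos[OF m(1)]
      by (intro mult_left_mono order_trans[OF abs_triangle_ineq] add_left_mono sum_abs) auto
    also have "\<dots> = c m * \<bar>S m \<omega>\<bar> + (\<Sum>j=n+1..m. c m * \<bar>row_change D j \<omega>\<bar>)"
      by (simp add: distrib_left sum_distrib_left)
    \<comment> \<open>Since \<open>j \<le> m\<close>, the weight \<open>c m\<close> is at most
      \<open>c j\<close>; the resulting bound \<open>T\<close> no longer depends on
      \<open>m\<close>.\<close>
    also have "(\<Sum>j=n+1..m. c m * \<bar>row_change D j \<omega>\<bar>) \<le> (\<Sum>j=n+1..m. c j * \<bar>row_change D j \<omega>\<bar>)"
      using c_mono assms(6) by (intro sum_mono mult_right_mono) auto
    also have "\<dots> \<le> T \<omega>"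
      unfolding T_def using m c_pos by (intro sum_mono2) (auto intro!: mult_nonneg_nonneg intro: less_imp_le)
    \<comment> \<open>The strict alternative falls to \<open>S\<close>, matching the strict
      inequality in \<open>hajek_renyi_chow\<close>; for \<open>T\<close>, Markov's inequality
      allows the weak one.\<close>
    finally have "lam / 2 < c m * \<bar>S m \<omega>\<bar> \<or> lam / 2 \<le> T \<omega>"
      using m(3) by linarith
    then show ?thesis
    proof
      assume "lam / 2 < c m * \<bar>S m \<omega>\<bar>"
      then have "a < (c m * \<bar>S m \<omega>\<bar>) powr p"
        unfolding a_def using assms(8,9) by (intro powr_less_mono2) auto
      then have "ennreal a < ennreal (c m powr p) * ennreal (\<bar>S m \<omega>\<bar> powr p)"
        using c_pos[OF m(1)]
        by (simp add: powr_mult ennreal_less_iff a_def flip: ennreal_mult)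
      then show ?thesis using \<omega>(1) m by (auto simp: E1_def)
    next
      assume "lam / 2 \<le> T \<omega>"
      then have "a \<le> T \<omega> powr p"
        unfolding a_def using assms(8,9) by (intro powr_mono2) auto
      then show ?thesis using \<omega>(1) by (auto simp: E2_def intro: ennreal_leI)
    qed
  qed
  have bound1: "ennreal a * emeasure M E1
      \<le> ennreal (c N powr p) * (\<integral>\<^sup>+\<omega>. ennreal (\<bar>S N \<omega>\<bar> powr p) \<partial>M)
        + (\<Sum>j=n..<N. ennreal (c j powr p - c (Suc j) powr p) * (\<integral>\<^sup>+\<omega>. ennreal (\<bar>S j \<omega>\<bar> powr p) \<partial>M))"
  proof -
    have "ennreal a * emeasure M {\<omega>\<in>space M. \<exists>k\<in>{n..N}. ennreal a < ennreal (c k powr p) * ennreal (\<bar>S k \<omega>\<bar> powr p)}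
      \<le> ennreal (c N powr p) * (\<integral>\<^sup>+\<omega>\<in>space M. ennreal (\<bar>S N \<omega>\<bar> powr p) \<partial>M)
        + (\<Sum>j=n..<N. ennreal (c j powr p - c (Suc j) powr p) * (\<integral>\<^sup>+\<omega>\<in>space M. ennreal (\<bar>S j \<omega>\<bar> powr p) \<partial>M))"
    \<comment> \<open>The filtration consists of the diagonal sigma-algebras, and the weights are
      \<open>c k powr p\<close>.\<close>
    proof (rule hajek_renyi_chow[where G="\<lambda>k. F k k"])
      show "subalgebra M (F k k)" if "n \<le> k" for k
        using that assms(6) by (intro sub) auto
      show "sets (F k k) \<subseteq> sets (F (Suc k) (Suc k))" if "n \<le> k" for k
        using that assms(6) by (intro mono) auto
      show "(\<lambda>\<omega>. ennreal (\<bar>S k \<omega>\<bar> powr p)) \<in> borel_measurable (F k k)" if "n \<le> k" for k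
        using S_meas[OF that] by measurable
      show "c (Suc k) powr p \<le> c k powr p" if "n \<le> k" for k
        using that assms(6,8) c_mono c_pos[of "Suc k"] by (intro powr_mono2) auto
      have "space M = space (F n n)" using sub[of n n] assms(6) by (simp add: subalgebra_def)
      then show "space M \<in> sets (F n n)" by simp
      show "(\<integral>\<^sup>+\<omega>\<in>B. ennreal (\<bar>S k \<omega>\<bar> powr p) \<partial>M) \<le> (\<integral>\<^sup>+\<omega>\<in>B. ennreal (\<bar>S (Suc k) \<omega>\<bar> powr p) \<partial>M)"
        if k: "n \<le> k" and B: "B \<in> sets (F k k)" for k B
      proof -
        have k1: "1 \<le> k" using k assms(6) by simp
        \<comment> \<open>The increment \<open>D (Suc k) (Suc k)\<close> is centred given
          \<open>F (Suc k) k\<close>, whereas \<open>S k\<close> and \<open>B\<close> live on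
          \<open>F k k\<close>. The two have the same sets because \<open>k \<ge> 1\<close>, so that
          the trivial index 0 does not occur.\<close>
        have eq: "sets (F (Suc k) k) = sets (F k k)"
          using assms(3)[of k k] assms(3)[of k "Suc k"] k1 by simp
        have "S k \<in> borel_measurable (F (Suc k) k)"
          using S_meas[OF k] by (subst measurable_cong_sets[OF eq refl])
        moreover have "integrable M (D (Suc k) (Suc k))"
            "AE \<omega> in M. real_cond_exp M (F (Suc k) k) (D (Suc k) (Suc k)) \<omega> = 0"
          using D_diag[of "Suc k"] by simp_all
        ultimately show ?thesis
          unfolding S_def extended_sum_Suc[OF k] using assms(8) B eq k1
          by (intro powr_martingale_step[where F="F (Suc k) k"] sub) (auto simp: S_def)
      qed
    qed (use assms(7) in auto)
    then show ?thesis
      by (simp add: E1_def cong: nn_integral_cong)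
  qed
  have bound2: "ennreal a * emeasure M E2 \<le> (\<integral>\<^sup>+\<omega>. ennreal (T \<omega> powr p) \<partial>M)"
  proof -
    have "ennreal a * emeasure M E2 = (\<integral>\<^sup>+\<omega>. ennreal a * indicator E2 \<omega> \<partial>M)"
      using E2 by (simp add: nn_integral_cmult_indicator)
    also have "\<dots> \<le> (\<integral>\<^sup>+\<omega>. ennreal (T \<omega> powr p) \<partial>M)"
      by (intro nn_integral_mono) (auto simp: E2_def indicator_def)
    finally show ?thesis .
  qed
  have "2 powr (- p) * lam powr p = a"
    using assms(9) by (simp add: a_def powr_divide powr_minus field_simps)
  then have "ennreal (2 powr (- p) * lam powr p) *
        emeasure M {\<omega> \<in> space M. Max ((\<lambda>m. c m * \<bar>row_sum D m m \<omega>\<bar>) ` {n..N}) > lam}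
      \<le> ennreal a * emeasure M (E1 \<union> E2)"
    using E1 E2 cover by (auto intro!: mult_left_mono emeasure_mono)
  also have "\<dots> \<le> ennreal a * (emeasure M E1 + emeasure M E2)"
    using E1 E2 by (intro mult_left_mono emeasure_subadditive) auto
  also have "\<dots> = ennreal a * emeasure M E1 + ennreal a * emeasure M E2"
    by (rule distrib_left)
  also note add_mono[OF bound1 bound2]
  finally show ?thesis
    by (simp add: S_def T_def)
qed

end
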